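(* Let $B_n$ denote the $n$-th Bernoulli number. The sequence $\{|B_{2n}|\}_{n\geq 1}$ is log-convex; that is, $|B_{2n}|^2\leq |B_{2n-2}|\cdot|B_{2n+2}|$ for all integers $n\geq 2$.
   Context: A sequence $\{a_n\}_{n\geq 1}$ of real numbers is log-convex if $a_n^2\leq a_{n-1}a_{n+1}$ for all $n\geq 2$. The Bernoulli numbers are the usual ones, so that $|B_{2n}|=\frac{2(2n)!}{(2\pi)^{2n}}\zeta(2n)$ for $n\ge 1$, where $\zeta$ is the Riemann zeta function. *)

theory Defs
  imports "HOL-Analysis.Analysis" "HOL-Computational_Algebra.Formal_Power_Series"
begin

text \<open>
  Bernoulli numbers via the generating function
  \<open>X / (e^X - 1) = (\<Sum>n. B_n X^n / n!)\<close>, a quotient of formal power series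
  (with this convention \<open>B_1 = -1/2\<close>).
\<close>
definition bernoulli :: "nat \<Rightarrow> real" where
  "bernoulli n = fact n * fps_nth (fps_X / (fps_exp 1 - 1)) n"

text \<open>
  Numerator and denominator both have order one, so the quotient is exact:
  it is not affected by the truncation built into \<open>fps\<close> division.
\<close>
lemma bernoulli_egf:
  "Abs_fps (\<lambda>n. bernoulli n / fact n) * (fps_exp 1 - 1) = (fps_X :: real fps)"
proof -
  have nz: "fps_nth (fps_exp (1::real) - 1) 1 \<noteq> 0" by simp
  hence "subdegree (fps_exp (1::real) - 1) = 1"
    by (intro subdegreeI) auto
  moreover have "fps_exp (1::real) - 1 \<noteq> 0" using nz by force
  ultimately have "(fps_exp (1::real) - 1) dvd fps_X"
    by (subst fps_dvd_iff) auto
  moreover have "Abs_fps (\<lambda>n. bernoulli n / fact n) = fps_X / (fps_exp (1::real) - 1)"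
    by (simp add: fps_eq_iff bernoulli_def)
  ultimately show ?thesis by simp
qed

text \<open>
  Log-convexity of a sequence indexed by \<open>n \<ge> 1\<close>; the value \<open>a 0\<close> is irrelevant,
  and \<open>n - 1\<close> does not truncate since \<open>n \<ge> 2\<close>.
\<close>
definition log_convex_seq :: "(nat \<Rightarrow> real) \<Rightarrow> bool" where
  "log_convex_seq a \<longleftrightarrow> (\<forall>n\<ge>2. (a n)\<^sup>2 \<le> a (n - 1) * a (n + 1))"

end

theory Submission
  imports Defs "HOL-Complex_Analysis.Complex_Analysis"
begin

text \<open>
  Euler's formula \<open>\<bar>B\<^bsub>2n\<^esub>\<bar> (2\<pi>)\<^bsup>2n\<^esup> / (2n)! = 2 \<zeta>(2n)\<close>
  (lemma \<open>abs_bernoulli_even\<close>) splits the claim into two log-convexity statements that may be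
  multiplied: \<open>\<zeta>(2n)\<^sup>2 \<le> \<zeta>(2n-2) \<zeta>(2n+2)\<close> is the Cauchy--Schwarz inequality applied to
  \<open>1/k\<^bsup>2n\<^esup> = 1/k\<^bsup>n-1\<^esup> \<cdot> 1/k\<^bsup>n+1\<^esup>\<close>, and \<open>((2n)!)\<^sup>2 \<le> (2n-2)! (2n+2)!\<close> is a comparison of
  consecutive factors. The powers of \<open>2\<pi>\<close> form a geometric progression and cancel.

  Euler's formula comes from two descriptions of \<open>\<pi>z cot(\<pi>z)\<close>. Taking the logarithmic
  derivative of the reflection formula \<open>\<Gamma>(1+z) \<Gamma>(1-z) sin(\<pi>z) = \<pi>z\<close> gives
  \<open>1 - \<pi>z cot(\<pi>z) = z (\<psi>(1+z) - \<psi>(1-z))\<close>, where \<open>\<psi>\<close> is the digamma function; its Taylor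
  coefficients at \<open>1\<close> in positive degree are zeta values up to sign, and the difference keeps
  those of odd degree.
  On the other hand, \<open>cot(\<pi>z)\<close> is a rational function of \<open>e\<^bsup>2\<pi>iz\<^esup>\<close>, and \<open>\<pi>z cot(\<pi>z)\<close> equals
  \<open>\<pi>iz + 2\<pi>iz / (e\<^bsup>2\<pi>iz\<^esup> - 1)\<close>, in which the last term is the generating function of the
  Bernoulli numbers at \<open>2\<pi>iz\<close>. The comparison is made between formal power series, and
  every identity is kept free of division, so that \<open>cot\<close> itself never appears.
\<close>

section \<open>The logarithmic derivative of the reflection formula\<close>

lemma Gamma_reflection_around_0:
  fixes z :: complex
  assumes "norm z < 1"
  shows "Gamma (1 + z) * Gamma (1 - z) * sin (of_real pi * z) = of_real pi * z"
proof (cases "z = 0")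
  case False
  with assms have "z \<notin> \<int>"
    by (auto elim!: Ints_cases)
  hence "z \<notin> \<int>\<^sub>\<le>\<^sub>0" and "sin (of_real pi * z) \<noteq> 0"
    by (auto simp: sin_eq_0)
  thus ?thesis
    using Gamma_plus1[of z] Gamma_reflection_complex[of z] by (simp add: add.commute field_simps)
qed auto

lemma one_plus_not_nonpos_Int:
  fixes z :: complex
  assumes "norm z < 1"
  shows "1 + z \<notin> \<int>\<^sub>\<le>\<^sub>0"
proof
  assume "1 + z \<in> \<int>\<^sub>\<le>\<^sub>0"
  then obtain n where "1 + z = - of_nat n"
    by (auto elim!: nonpos_Ints_cases')
  hence "Re z = - real n - 1"
    by (simp add: complex_eq_iff)
  with abs_Re_le_cmod[of z] assms show False
    by linarith
qed

text \<open>
  Differentiating the reflection formula gives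
  \<open>\<Gamma>(1+z) \<Gamma>(1-z) (D(z) sin(\<pi>z) + \<pi> cos(\<pi>z)) = \<pi>\<close> with \<open>D(z) = \<psi>(1+z) - \<psi>(1-z)\<close>. After
  multiplication by \<open>z\<close> the right-hand side is the reflection formula again, so the
  nonvanishing Gamma factors cancel.
\<close>
lemma Digamma_diff_sin_cos:
  fixes z :: complex
  assumes "norm z < 1"
  shows "z * (Digamma (1 + z) - Digamma (1 - z)) * sin (of_real pi * z)
           + of_real pi * z * cos (of_real pi * z) = sin (of_real pi * z)"
proof -
  define G where "G = Gamma (1 + z) * Gamma (1 - z)"
  define D where "D = Digamma (1 + z) - Digamma (1 - z)"
  have notin: "1 + z \<notin> \<int>\<^sub>\<le>\<^sub>0" "1 - z \<notin> \<int>\<^sub>\<le>\<^sub>0"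
    using assms one_plus_not_nonpos_Int[of z] one_plus_not_nonpos_Int[of "- z"] by auto
  hence "G \<noteq> 0"
    by (simp add: G_def Gamma_eq_zero_iff)
  have "((\<lambda>z. Gamma (1 + z) * Gamma (1 - z) * sin (of_real pi * z)) has_field_derivative
          G * D * sin (of_real pi * z) + G * (of_real pi * cos (of_real pi * z))) (at z)"
    using notin by (auto intro!: derivative_eq_intros simp: G_def D_def algebra_simps)
  moreover have "eventually (\<lambda>z::complex. norm z < 1) (nhds z)"
    using eventually_nhds_in_open[of "ball 0 1" z] assms by simp
  hence "eventually (\<lambda>z. Gamma (1 + z) * Gamma (1 - z) * sin (of_real pi * z)
                         = of_real pi * z) (nhds z)"
    by eventually_elim (rule Gamma_reflection_around_0)
  ultimately have "((\<lambda>z. of_real pi * z) has_field_derivative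
          G * D * sin (of_real pi * z) + G * (of_real pi * cos (of_real pi * z))) (at z)"
    by (subst (asm) DERIV_cong_ev[OF refl _ refl])
  moreover have "((\<lambda>z. of_real pi * z) has_field_derivative of_real pi) (at z)"
    by (auto intro!: derivative_eq_intros)
  ultimately have "G * D * sin (of_real pi * z) + G * (of_real pi * cos (of_real pi * z)) = of_real pi"
    by (rule DERIV_unique)
  hence "z * (G * D * sin (of_real pi * z) + G * (of_real pi * cos (of_real pi * z)))
           = G * sin (of_real pi * z)"
    using Gamma_reflection_around_0[OF assms] by (simp add: G_def mult.commute)
  hence "G * (z * D * sin (of_real pi * z) + of_real pi * z * cos (of_real pi * z))
           = G * sin (of_real pi * z)"
    by (simp add: algebra_simps)
  thus ?thesis
    using \<open>G \<noteq> 0\<close> by (simp add: D_def)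
qed

section \<open>Euler's formula for the even zeta values\<close>

text \<open>
  The Taylor series of \<open>\<psi>(1+z) - \<psi>(1-z)\<close> at \<open>0\<close>; the factor \<open>1 - (-1)\<^sup>n\<close> selects the odd part.
\<close>
definition Digamma_diff_fps :: "complex fps" where
  "Digamma_diff_fps = Abs_fps (\<lambda>n. (1 - (-1) ^ n) * Polygamma n 1 / fact n)"

lemma has_fps_expansion_Digamma_diff:
  "(\<lambda>z. Digamma (1 + z) - Digamma (1 - z)) has_fps_expansion Digamma_diff_fps"
proof -
  define F where "F = fps_expansion Digamma (1::complex)"
  have F: "(\<lambda>z. Digamma (1 + z)) has_fps_expansion F"
    unfolding F_def by (rule analytic_at_imp_has_fps_expansion) (auto intro!: analytic_on_Polygamma)
  have "((\<lambda>z. Digamma (1 + z)) \<circ> (\<lambda>z. - z)) has_fps_expansion (F oo (- fps_X))"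
    by (rule has_fps_expansion_compose[OF F]) (auto intro!: fps_expansion_intros)
  with F have "(\<lambda>z. Digamma (1 + z) - Digamma (1 - z)) has_fps_expansion (F - (F oo (- fps_X)))"
    using has_fps_expansion_diff by (fastforce simp: o_def)
  also have "F - (F oo (- fps_X)) = Digamma_diff_fps"
    unfolding fps_compose_uminus'
    by (simp add: fps_eq_iff F_def fps_expansion_def Digamma_diff_fps_def higher_deriv_Polygamma
                  left_diff_distrib diff_divide_distrib)
  finally show ?thesis .
qed

lemma Digamma_diff_fps_sin_cos:
  "fps_X * Digamma_diff_fps * fps_sin (of_real pi) + fps_const (of_real pi) * fps_X * fps_cos (of_real pi)
     = fps_sin (of_real pi)" (is "?F = ?G")
proof (rule fps_expansion_unique_complex)
  show "(\<lambda>z. z * (Digamma (1 + z) - Digamma (1 - z)) * sin (of_real pi * z)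
               + of_real pi * z * cos (of_real pi * z)) has_fps_expansion ?F"
    by (intro fps_expansion_intros has_fps_expansion_Digamma_diff)
  have "eventually (\<lambda>z::complex. norm z < 1) (nhds 0)"
    using eventually_nhds_in_open[of "ball 0 1" "0::complex"] by simp
  hence "eventually (\<lambda>z::complex. z * (Digamma (1 + z) - Digamma (1 - z)) * sin (of_real pi * z)
               + of_real pi * z * cos (of_real pi * z) = sin (of_real pi * z)) (nhds 0)"
    by eventually_elim (rule Digamma_diff_sin_cos)
  thus "(\<lambda>z. z * (Digamma (1 + z) - Digamma (1 - z)) * sin (of_real pi * z)
               + of_real pi * z * cos (of_real pi * z)) has_fps_expansion ?G"
    by (subst has_fps_expansion_cong[OF _ refl]) (auto intro: fps_expansion_intros)
qed

text \<open>The generating function of the Bernoulli numbers after the substitution \<open>X \<mapsto> cX\<close>.\<close>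
lemma bernoulli_egf_scaled:
  fixes c :: complex
  shows "Abs_fps (\<lambda>n. c ^ n * of_real (bernoulli n / fact n)) * (fps_exp c - 1) = fps_const c * fps_X"
proof -
  define B :: "complex fps" where "B = Abs_fps (\<lambda>n. of_real (bernoulli n / fact n))"
  have "B * (fps_exp 1 - 1) = fps_X"
  proof (rule fps_ext)
    fix n
    have "fps_nth (B * (fps_exp 1 - 1)) n
            = of_real (fps_nth (Abs_fps (\<lambda>n. bernoulli n / fact n) * (fps_exp 1 - 1)) n)"
      by (auto simp: fps_mult_nth B_def intro!: sum.cong)
    also have "\<dots> = fps_nth fps_X n"
      by (simp only: bernoulli_egf) (simp add: fps_X_def)
    finally show "fps_nth (B * (fps_exp 1 - 1)) n = fps_nth fps_X n" .
  qed
  hence "(B * (fps_exp 1 - 1)) oo (fps_const c * fps_X) = fps_X oo (fps_const c * fps_X)"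
    by simp
  hence "(B oo (fps_const c * fps_X)) * (fps_exp c - 1) = fps_const c * fps_X"
    by (simp add: fps_compose_mult_distrib fps_compose_sub_distrib)
  thus ?thesis
    by (simp add: fps_compose_linear B_def)
qed

text \<open>
  Multiplying the sine--cosine identity by \<open>2i e\<^bsup>\<pi>iX\<^esup>\<close> turns it into an identity in
  \<open>E = e\<^bsup>2\<pi>iX\<^esup>\<close>, namely \<open>(1 - X D) (E - 1) = \<pi>iX (E + 1)\<close>. The series on the left below
  satisfies the same equation, because \<open>2\<pi>iX + \<pi>iX (E - 1) = \<pi>iX (E + 1)\<close>.
\<close>
lemma bernoulli_egf_eq_Digamma_diff:
  "Abs_fps (\<lambda>n. (2 * pi * \<i>) ^ n * of_real (bernoulli n / fact n)) + fps_const (pi * \<i>) * fps_X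
     = 1 - fps_X * Digamma_diff_fps"
proof -
  define p where "p = fps_const (of_real pi :: complex)"
  define I where "I = fps_const \<i>"
  define S where "S = fps_sin (of_real pi :: complex)"
  define C where "C = fps_cos (of_real pi :: complex)"
  define e where "e = fps_exp (\<i> * of_real pi)"
  define E where "E = fps_exp (2 * pi * \<i>)"
  define B where "B = Abs_fps (\<lambda>n. (2 * pi * \<i>) ^ n * of_real (bernoulli n / fact n))"
  have e: "e = C + I * S"
    unfolding e_def C_def I_def S_def by (rule fps_exp_ii_sin_cos)
  have E: "E = e * e"
    by (simp add: E_def e_def fps_exp_add_mult[symmetric] mult_ac)
  have II: "I * I = - 1"
    by (simp add: I_def fps_eq_iff)
  have CS: "C * C + S * S = 1"
    using fps_sin_cos_sum_of_squares[of "of_real pi :: complex"]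
    by (simp add: C_def S_def power2_eq_square)
  have E_minus_1: "E - 1 = 2 * I * e * S" and E_plus_1: "E + 1 = 2 * e * C"
    using II CS unfolding E e by algebra+
  have "fps_X * Digamma_diff_fps * S + p * fps_X * C = S"
    using Digamma_diff_fps_sin_cos by (simp add: p_def S_def C_def)
  hence S: "(1 - fps_X * Digamma_diff_fps) * S = p * fps_X * C"
    by (simp add: algebra_simps)
  have "(1 - fps_X * Digamma_diff_fps) * (E - 1) = 2 * I * e * ((1 - fps_X * Digamma_diff_fps) * S)"
    unfolding E_minus_1 by (simp only: mult_ac)
  also have "\<dots> = p * I * fps_X * (E + 1)"
    unfolding S E_plus_1 by (simp only: mult_ac)
  finally have "(1 - fps_X * Digamma_diff_fps) * (E - 1) = p * I * fps_X * (E + 1)" .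
  moreover have "B * (E - 1) = 2 * p * I * fps_X"
    using bernoulli_egf_scaled[of "2 * pi * \<i>"]
    by (simp add: B_def E_def p_def I_def numeral_fps_const)
  hence "(B + p * I * fps_X) * (E - 1) = p * I * fps_X * (E + 1)"
    by algebra
  moreover have "fps_nth (E - 1) 1 \<noteq> 0"
    by (simp add: E_def)
  hence "E - 1 \<noteq> 0"
    by force
  ultimately have "B + p * I * fps_X = 1 - fps_X * Digamma_diff_fps"
    by (metis mult_right_cancel)
  thus ?thesis
    by (simp add: B_def p_def I_def)
qed

lemma summable_even_powers:
  assumes "n \<ge> 1"
  shows "summable (\<lambda>k. 1 / real (Suc k) ^ (2 * n))"
  using Polygamma_converges'[of "1::real" "2 * n"] assms
  by (simp add: inverse_eq_divide add.commute)

lemma Polygamma_odd_at_1: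
  assumes "n \<ge> 1"
  shows "Polygamma (2 * n - 1) (1::complex)
           = fact (2 * n - 1) * of_real (\<Sum>k. 1 / real (Suc k) ^ (2 * n))"
proof -
  have "(\<lambda>k. 1 / real (Suc k) ^ (2 * n)) sums (Polygamma (2 * n - 1) 1 / fact (2 * n - 1))"
    using Polygamma_LIMSEQ[of "1::real" "2 * n - 1"] assms
    by (simp add: inverse_eq_divide add.commute)
  hence "Polygamma (2 * n - 1) (1::real) = fact (2 * n - 1) * (\<Sum>k. 1 / real (Suc k) ^ (2 * n))"
    by (simp add: sums_iff field_simps)
  thus ?thesis
    using Polygamma_of_real[of "1::real" "2 * n - 1", where 'a = complex] by simp
qed

text \<open>Euler's formula: compare the coefficients of \<open>X\<^bsup>2n\<^esup>\<close> in the preceding identity,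
  where the linear term \<open>\<pi>iX\<close> does not contribute. Absolute values absorb the sign of
  \<open>(2\<pi>i)\<^bsup>2n\<^esup>\<close>.\<close>
lemma abs_bernoulli_even:
  assumes "n \<ge> 1"
  shows "\<bar>bernoulli (2 * n)\<bar> = 2 * fact (2 * n) / (2 * pi) ^ (2 * n) * (\<Sum>k. 1 / real (Suc k) ^ (2 * n))"
proof -
  define Z where "Z = (\<Sum>k. 1 / real (Suc k) ^ (2 * n))"
  have Z: "Z \<ge> 0"
    unfolding Z_def using summable_even_powers[OF assms] by (intro suminf_nonneg) auto
  have odd: "odd (2 * n - 1)"
    using assms by presburger
  have "(2 * pi * \<i>) ^ (2 * n) * of_real (bernoulli (2 * n) / fact (2 * n))
          = - fps_nth Digamma_diff_fps (2 * n - 1)"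
    using arg_cong[OF bernoulli_egf_eq_Digamma_diff, of "\<lambda>F. fps_nth F (2 * n)"] assms
    by simp
  also have "\<dots> = - of_real (2 * Z)"
    using Polygamma_odd_at_1[OF assms] odd by (simp add: Digamma_diff_fps_def Z_def)
  finally have "norm ((2 * pi * \<i>) ^ (2 * n) * of_real (bernoulli (2 * n) / fact (2 * n)))
                  = norm (- complex_of_real (2 * Z))"
    by simp
  hence "(2 * pi) ^ (2 * n) * (\<bar>bernoulli (2 * n)\<bar> / fact (2 * n)) = 2 * Z"
    using Z by (simp add: norm_mult norm_power norm_divide del: power_mult)
  thus ?thesis
    unfolding Z_def[symmetric] by (simp add: field_simps)
qed

section \<open>Log-convexity\<close>

lemma suminf_Cauchy_Schwarz:
  fixes a b :: "nat \<Rightarrow> real"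
  assumes "summable (\<lambda>k. (a k)\<^sup>2)" "summable (\<lambda>k. (b k)\<^sup>2)" "summable (\<lambda>k. a k * b k)"
  shows "(\<Sum>k. a k * b k)\<^sup>2 \<le> (\<Sum>k. (a k)\<^sup>2) * (\<Sum>k. (b k)\<^sup>2)"
proof (rule LIMSEQ_le)
  show "(\<lambda>n. (\<Sum>k<n. a k * b k)\<^sup>2) \<longlonglongrightarrow> (\<Sum>k. a k * b k)\<^sup>2"
    by (intro tendsto_intros summable_LIMSEQ assms)
  show "(\<lambda>n. (\<Sum>k<n. (a k)\<^sup>2) * (\<Sum>k<n. (b k)\<^sup>2)) \<longlonglongrightarrow> (\<Sum>k. (a k)\<^sup>2) * (\<Sum>k. (b k)\<^sup>2)"
    by (intro tendsto_intros summable_LIMSEQ assms)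
qed (use Cauchy_Schwarz_ineq_sum in blast)

lemma even_zeta_log_convex:
  assumes "n \<ge> 2"
  shows "(\<Sum>k. 1 / real (Suc k) ^ (2 * n))\<^sup>2
           \<le> (\<Sum>k. 1 / real (Suc k) ^ (2 * (n - 1))) * (\<Sum>k. 1 / real (Suc k) ^ (2 * (n + 1)))"
proof -
  define a where "a k = 1 / real (Suc k) ^ (n - 1)" for k
  define b where "b k = 1 / real (Suc k) ^ (n + 1)" for k
  have "2 * n = (n - 1) + (n + 1)"
    using assms by simp
  hence ab: "1 / real (Suc k) ^ (2 * n) = a k * b k" for k
    by (simp only: a_def b_def power_add) simp
  have a: "1 / real (Suc k) ^ (2 * (n - 1)) = (a k)\<^sup>2"
   and b: "1 / real (Suc k) ^ (2 * (n + 1)) = (b k)\<^sup>2" for k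
    unfolding a_def b_def by (simp_all only: power_divide power_one power_mult[symmetric] mult.commute)
  show ?thesis
    using summable_even_powers[of n] summable_even_powers[of "n - 1"]
          summable_even_powers[of "n + 1"] assms
    unfolding ab a b by (intro suminf_Cauchy_Schwarz) auto
qed

lemma fact_even_log_convex:
  assumes "n \<ge> 1"
  shows "(fact (2 * n))\<^sup>2 \<le> (fact (2 * (n - 1)) * fact (2 * (n + 1)) :: real)"
proof -
  obtain m where n: "n = Suc m"
    using assms by (cases n) auto
  define F where "F = (fact (2 * m) :: real)"
  have mid: "fact (2 * n) = real ((2 * m + 1) * (2 * m + 2)) * F"
    by (simp add: n F_def algebra_simps)
  have "(fact (2 * n))\<^sup>2 = (fact (2 * n) * F) * real ((2 * m + 1) * (2 * m + 2))"
    by (simp add: mid power2_eq_square)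
  also have "\<dots> \<le> (fact (2 * n) * F) * real ((2 * m + 3) * (2 * m + 4))"
    by (intro mult_left_mono of_nat_mono mult_mono) (auto simp: F_def)
  also have "\<dots> = fact (2 * (n - 1)) * fact (2 * (n + 1))"
    by (simp add: n F_def algebra_simps)
  finally show ?thesis .
qed

theorem corollary2p3:
  shows "log_convex_seq (\<lambda>n. \<bar>bernoulli (2 * n)\<bar>)"
  unfolding log_convex_seq_def
proof (intro allI impI)
  fix n :: nat
  assume n: "n \<ge> 2"
  define Z where "Z m = (\<Sum>k. 1 / real (Suc k) ^ (2 * m))" for m :: nat
  define P where "P m = (2 * pi) ^ (2 * m)" for m :: nat
  have B: "\<bar>bernoulli (2 * m)\<bar> = 2 * fact (2 * m) / P m * Z m" if "m \<ge> 1" for m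
    using abs_bernoulli_even[OF that] by (simp add: Z_def P_def)
  have "2 * (n - 1) + 2 * (n + 1) = 2 * n * 2"
    using n by simp
  hence P: "P (n - 1) * P (n + 1) = (P n)\<^sup>2"
    by (simp only: P_def power_add[symmetric] power_mult[symmetric])
  have "\<bar>bernoulli (2 * n)\<bar>\<^sup>2 = 4 / (P n)\<^sup>2 * ((fact (2 * n))\<^sup>2 * (Z n)\<^sup>2)"
    using n by (simp add: B power_mult_distrib power_divide)
  also have "\<dots> \<le> 4 / (P n)\<^sup>2 * ((fact (2 * (n - 1)) * fact (2 * (n + 1))) * (Z (n - 1) * Z (n + 1)))"
    using n fact_even_log_convex[of n] even_zeta_log_convex[of n]
    by (intro mult_left_mono mult_mono) (auto simp: Z_def)
  also have "\<dots> = (2 * fact (2 * (n - 1)) / P (n - 1) * Z (n - 1))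
                     * (2 * fact (2 * (n + 1)) / P (n + 1) * Z (n + 1))"
    unfolding P[symmetric] by (simp only: times_divide_times_eq times_divide_eq_left) (simp add: mult_ac)
  also have "\<dots> = \<bar>bernoulli (2 * (n - 1))\<bar> * \<bar>bernoulli (2 * (n + 1))\<bar>"
    using B[of "n - 1"] B[of "n + 1"] n by simp
  finally show "\<bar>bernoulli (2 * n)\<bar>\<^sup>2 \<le> \<bar>bernoulli (2 * (n - 1))\<bar> * \<bar>bernoulli (2 * (n + 1))\<bar>" .
qed

end
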